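(* Let $n\ge2$, let $\Sigma\in\mathbb{R}^{d\times d}$, and let $b=(b_k)_{k\in\mathbb{Z}}$ be an $\mathbb{R}^d$-valued wide-sense stationary process with autocorrelation function $$R_b(k)=\left(\left(1+\tfrac{1}{n-1}\right)\mathbf{1}_{k\equiv0\ (\mathrm{mod}\ n)}-\tfrac{1}{n-1}\right)\Sigma,\qquad k\in\mathbb{Z}.$$ Let $h=(H_k)_{k\in\mathbb{Z}}$, $H_k\in\mathbb{R}^{d\times d}$, be absolutely summable, $\sum_k\|H_k\|<\infty$, with transfer function $H(z)=\sum_{k\in\mathbb{Z}}H_kz^{-k}$. Then the process $x=h*b$, $x_k=\sum_{k'\in\mathbb{Z}}H_{k-k'}b_{k'}$, satisfies for every $k$ $$\mathbb{E}[\|x_k\|^2]=\frac1{n-1}\sum_{k'=1}^{n-1}\mathrm{Tr}\left[\Sigma\,H(e^{\frac{2\pi ik'}{n}})^\top H(e^{-\frac{2\pi ik'}{n}})\right].$$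
   Context: An $\mathbb{R}^d$-valued process $(y_k)_{k\in\mathbb{Z}}$ is wide-sense stationary if $\mathbb{E}[\|y_k\|^2]<\infty$ for all $k$ and its mean $\mathbb{E}[y_k]$ and autocovariance between times $k$ and $k+\kappa$ do not depend on $k$; its autocorrelation function is $R_y(\kappa)=\mathbb{E}[y_ky_{k+\kappa}^\top]$. *)

theory Defs
  imports "HOL-Probability.Probability" "HOL-Number_Theory.Cong"
begin

definition outer_product :: "real ^ 'd \<Rightarrow> real ^ 'd \<Rightarrow> real ^ 'd ^ 'd" where
  "outer_product x y = (\<chi> i j. x $ i * y $ j)"

definition autocovariance ::
    "'w measure \<Rightarrow> (int \<Rightarrow> 'w \<Rightarrow> real ^ 'd) \<Rightarrow> int \<Rightarrow> int \<Rightarrow> real ^ 'd ^ 'd" where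
  "autocovariance M y k l =
    (\<integral>\<omega>. outer_product (y k \<omega> - (\<integral>\<eta>. y k \<eta> \<partial>M)) (y l \<omega> - (\<integral>\<eta>. y l \<eta> \<partial>M)) \<partial>M)"

definition wide_sense_stationary :: "'w measure \<Rightarrow> (int \<Rightarrow> 'w \<Rightarrow> real ^ 'd) \<Rightarrow> bool" where
  "wide_sense_stationary M y \<longleftrightarrow>
    prob_space M \<and>
    (\<forall>k. y k \<in> borel_measurable M) \<and>
    (\<forall>k. integrable M (\<lambda>\<omega>. (norm (y k \<omega>))\<^sup>2)) \<and>
    (\<forall>k l. (\<integral>\<omega>. y k \<omega> \<partial>M) = (\<integral>\<omega>. y l \<omega> \<partial>M)) \<and>
    (\<forall>\<kappa> k l. autocovariance M y k (k + \<kappa>) = autocovariance M y l (l + \<kappa>))"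

(* Based at time 0; for a wide-sense stationary process the base point is irrelevant,
   see autocorrelation_base_point below. *)
definition autocorrelation ::
    "'w measure \<Rightarrow> (int \<Rightarrow> 'w \<Rightarrow> real ^ 'd) \<Rightarrow> int \<Rightarrow> real ^ 'd ^ 'd" where
  "autocorrelation M y \<kappa> = (\<integral>\<omega>. outer_product (y 0 \<omega>) (y \<kappa> \<omega>) \<partial>M)"

(* Pointwise in the sample space. infsum is 0 wherever the series fails to converge. *)
definition filtered_process ::
    "(int \<Rightarrow> real ^ 'd ^ 'd) \<Rightarrow> (int \<Rightarrow> 'w \<Rightarrow> real ^ 'd) \<Rightarrow> int \<Rightarrow> 'w \<Rightarrow> real ^ 'd" where
  "filtered_process H b k \<omega> = (\<Sum>\<^sub>\<infinity>k'\<in>UNIV. H (k - k') *v b k' \<omega>)"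

definition transfer_function ::
    "(int \<Rightarrow> real ^ 'd ^ 'd) \<Rightarrow> complex \<Rightarrow> complex ^ 'd ^ 'd" where
  "transfer_function H z =
    (\<Sum>\<^sub>\<infinity>k\<in>UNIV. map_matrix (\<lambda>a. complex_of_real a * z powi (- k)) (H k))"

lemma bounded_bilinear_outer_product:
  "bounded_bilinear (outer_product :: real ^ 'd \<Rightarrow> real ^ 'd \<Rightarrow> real ^ 'd ^ 'd)"
  unfolding bilinear_conv_bounded_bilinear[symmetric] bilinear_def
  by (auto intro!: linearI simp: outer_product_def vec_eq_iff algebra_simps)

lemma integrable_outer_product:
  fixes f g :: "'w \<Rightarrow> real ^ 'd"
  assumes f: "f \<in> borel_measurable M" "integrable M (\<lambda>\<omega>. (norm (f \<omega>))\<^sup>2)"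
    and g: "g \<in> borel_measurable M" "integrable M (\<lambda>\<omega>. (norm (g \<omega>))\<^sup>2)"
  shows "integrable M (\<lambda>\<omega>. outer_product (f \<omega>) (g \<omega>))"
proof -
  obtain K where K: "K > 0"
    "\<And>x y :: real ^ 'd. norm (outer_product x y) \<le> norm x * norm y * K"
    using bounded_bilinear.pos_bounded[OF bounded_bilinear_outer_product] by blast
  have le: "norm (outer_product x y) \<le> ((norm x)\<^sup>2 + (norm y)\<^sup>2) * K" for x y :: "real ^ 'd"
  proof -
    have "2 * norm x * norm y \<le> (norm x)\<^sup>2 + (norm y)\<^sup>2"
      by (rule sum_squares_bound)
    moreover have "0 \<le> norm x * norm y" by simp
    ultimately have "norm x * norm y \<le> (norm x)\<^sup>2 + (norm y)\<^sup>2" by linarith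
    then show ?thesis
      using K(2)[of x y] K(1) by (meson mult_right_mono less_imp_le order_trans)
  qed
  have cont: "continuous_on UNIV (\<lambda>p :: (real ^ 'd) \<times> (real ^ 'd). outer_product (fst p) (snd p))"
    by (intro bounded_bilinear.continuous_on[OF bounded_bilinear_outer_product] continuous_intros)
  have meas: "(\<lambda>\<omega>. outer_product (f \<omega>) (g \<omega>)) \<in> borel_measurable M"
    using borel_measurable_continuous_Pair[OF f(1) g(1), of outer_product] cont by simp
  have "integrable M (\<lambda>\<omega>. ((norm (f \<omega>))\<^sup>2 + (norm (g \<omega>))\<^sup>2) * K)"
    using f g by simp
  then show ?thesis
    by (rule Bochner_Integration.integrable_bound) (auto intro!: AE_I2 meas order_trans[OF le])
qed

lemma autocorrelation_base_point:
  fixes y :: "int \<Rightarrow> 'w \<Rightarrow> real ^ 'd"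
  assumes wss: "wide_sense_stationary M y"
  shows "(\<integral>\<omega>. outer_product (y k \<omega>) (y (k + \<kappa>) \<omega>) \<partial>M) = autocorrelation M y \<kappa>"
proof -
  interpret prob_space M using wss by (simp add: wide_sense_stationary_def)
  interpret op: bounded_bilinear "outer_product :: real ^ 'd \<Rightarrow> real ^ 'd \<Rightarrow> real ^ 'd ^ 'd"
    by (rule bounded_bilinear_outer_product)
  have [measurable]: "y k \<in> borel_measurable M" for k
    using wss by (simp add: wide_sense_stationary_def)
  have sq: "integrable M (\<lambda>\<omega>. (norm (y k \<omega>))\<^sup>2)" for k
    using wss by (simp add: wide_sense_stationary_def)
  have int: "integrable M (y k)" for k
    using square_integrable_imp_integrable[of "\<lambda>\<omega>. norm (y k \<omega>)", OF _ sq]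
    by (simp add: integrable_norm_iff)
  define m where "m = (\<integral>\<omega>. y 0 \<omega> \<partial>M)"
  have m: "(\<integral>\<omega>. y k \<omega> \<partial>M) = m" for k
    using wss unfolding wide_sense_stationary_def m_def by blast
  have corr: "(\<integral>\<omega>. outer_product (y k \<omega>) (y l \<omega>) \<partial>M) = autocovariance M y k l + outer_product m m"
    for k l
  proof -
    have i1: "integrable M (\<lambda>\<omega>. outer_product (y k \<omega>) (y l \<omega>))"
      by (intro integrable_outer_product sq) simp_all
    have i2: "integrable M (\<lambda>\<omega>. outer_product (y k \<omega>) m)"
      by (rule integrable_bounded_linear[OF op.bounded_linear_left int])
    have i3: "integrable M (\<lambda>\<omega>. outer_product m (y l \<omega>))"
      by (rule integrable_bounded_linear[OF op.bounded_linear_right int])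
    have e2: "(\<integral>\<omega>. outer_product (y k \<omega>) m \<partial>M) = outer_product m m"
      using integral_bounded_linear[OF op.bounded_linear_left int, of k m] m by simp
    have e3: "(\<integral>\<omega>. outer_product m (y l \<omega>) \<partial>M) = outer_product m m"
      using integral_bounded_linear[OF op.bounded_linear_right int, of m l] m by simp
    have "autocovariance M y k l =
        (\<integral>\<omega>. outer_product (y k \<omega>) (y l \<omega>) - outer_product (y k \<omega>) m
            - outer_product m (y l \<omega>) + outer_product m m \<partial>M)"
      unfolding autocovariance_def m
      by (simp add: op.diff_left op.diff_right algebra_simps)
    also have "\<dots> = (\<integral>\<omega>. outer_product (y k \<omega>) (y l \<omega>) \<partial>M) - outer_product m m"
      using i1 i2 i3 e2 e3 by (simp add: prob_space)
    finally show ?thesis by simp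
  qed
  have "autocovariance M y k (k + \<kappa>) = autocovariance M y 0 (0 + \<kappa>)"
    using wss unfolding wide_sense_stationary_def by blast
  then show ?thesis
    unfolding autocorrelation_def by (simp add: corr)
qed

end

theory Submission
  imports Defs
begin

text \<open>
  Expand the square of the norm of \<open>x\<^sub>k = \<Sum>\<^sub>j H\<^sub>j b\<^sub>k\<^sub>-\<^sub>j\<close> into the double series of the inner products
  of \<open>H\<^sub>j b\<^sub>k\<^sub>-\<^sub>j\<close> and \<open>H\<^sub>i b\<^sub>k\<^sub>-\<^sub>i\<close>. Since the second moment of \<open>b\<close> is constant in time and \<open>H\<close> is
  absolutely summable, the series may be integrated termwise, and the term at \<open>(i, j)\<close> has
  expectation \<open>r (j - i) Tr (\<Sigma> H\<^sub>i\<^sup>T H\<^sub>j)\<close>, where \<open>R\<^sub>b = r \<Sigma>\<close>. The scalar \<open>r m\<close> is the average of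
  \<open>z\<^sup>m\<close> over the \<open>n\<close>-th roots of unity \<open>z \<noteq> 1\<close>, and for each such \<open>z\<close> the double series of
  \<open>z\<^sup>j\<^sup>-\<^sup>i Tr (\<Sigma> H\<^sub>i\<^sup>T H\<^sub>j)\<close> factors as \<open>Tr (\<Sigma> H(z)\<^sup>T H(1/z))\<close>.
\<close>

section \<open>Unconditional series: termwise integration, measurability, bilinear products\<close>

lemma has_sum_sum:
  fixes f :: "'q \<Rightarrow> 'i \<Rightarrow> 'b :: topological_comm_monoid_add"
  assumes "\<And>q. q \<in> Q \<Longrightarrow> (f q has_sum S q) A"
  shows "((\<lambda>i. \<Sum>q\<in>Q. f q i) has_sum (\<Sum>q\<in>Q. S q)) A"
  using assms by (induction Q rule: infinite_finite_induct) (auto intro!: has_sum_add has_sum_0)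

text \<open>
  Extension by zero along \<^const>\<open>to_nat\<close>: it makes the library results on series over the natural
  numbers available for sums over a countable, possibly finite, index type.
\<close>
definition nat_extend :: "('i :: countable \<Rightarrow> 'b :: zero) \<Rightarrow> nat \<Rightarrow> 'b" where
  "nat_extend f m = (if m \<in> range (to_nat :: 'i \<Rightarrow> nat) then f (from_nat m) else 0)"

lemma has_sum_nat_extend:
  fixes f :: "'i :: countable \<Rightarrow> 'b :: {comm_monoid_add, topological_space}"
  shows "(nat_extend f has_sum S) UNIV \<longleftrightarrow> (f has_sum S) UNIV"
proof -
  have "(nat_extend f has_sum S) UNIV \<longleftrightarrow>
      (nat_extend f has_sum S) (range (to_nat :: 'i \<Rightarrow> nat))"
    by (rule has_sum_cong_neutral) (auto simp: nat_extend_def)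
  also have "\<dots> \<longleftrightarrow> (nat_extend f \<circ> (to_nat :: 'i \<Rightarrow> nat) has_sum S) UNIV"
    by (rule has_sum_reindex) simp
  also have "nat_extend f \<circ> to_nat = f"
    by (auto simp: nat_extend_def)
  finally show ?thesis .
qed

lemma summable_on_nat_extend:
  fixes f :: "'i :: countable \<Rightarrow> 'b :: {comm_monoid_add, topological_space}"
  shows "nat_extend f summable_on UNIV \<longleftrightarrow> f summable_on UNIV"
  by (simp add: summable_on_def has_sum_nat_extend)

lemma summable_nat_extend_norm:
  fixes f :: "'i :: countable \<Rightarrow> 'b :: real_normed_vector"
  shows "summable (\<lambda>m. norm (nat_extend f m)) \<longleftrightarrow> (\<lambda>i. norm (f i)) summable_on UNIV"
proof -
  have "(\<lambda>m. norm (nat_extend f m)) = nat_extend (\<lambda>i. norm (f i))"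
    by (auto simp: nat_extend_def)
  then show ?thesis
    using summable_on_UNIV_nonneg_real_iff[of "\<lambda>m. norm (nat_extend f m)"]
      summable_on_nat_extend[of "\<lambda>i. norm (f i)"]
    by simp
qed

text \<open>By Tonelli the series of norms has finite integral, so it is finite almost
  everywhere.\<close>

lemma AE_norm_summable_on:
  fixes f :: "'i :: countable \<Rightarrow> 'w \<Rightarrow> 'b :: {banach, second_countable_topology}"
  assumes int: "\<And>i. integrable M (f i)"
    and sum: "(\<lambda>i. \<integral>\<omega>. norm (f i \<omega>) \<partial>M) summable_on UNIV"
  shows "AE \<omega> in M. (\<lambda>i. norm (f i \<omega>)) summable_on UNIV"
proof -
  define g where "g = (\<lambda>m \<omega>. nat_extend (\<lambda>i. f i \<omega>) m)"
  have int_g: "integrable M (g m)" for m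
    using int by (cases "m \<in> range (to_nat :: 'i \<Rightarrow> nat)") (auto simp: g_def nat_extend_def)
  have "(\<integral>\<omega>. norm (g m \<omega>) \<partial>M) = nat_extend (\<lambda>i. \<integral>\<omega>. norm (f i \<omega>) \<partial>M) m" for m
    by (auto simp: g_def nat_extend_def)
  then have sum_g: "summable (\<lambda>m. \<integral>\<omega>. norm (g m \<omega>) \<partial>M)"
    using sum by (intro summable_on_imp_summable) (simp add: summable_on_nat_extend)
  have [measurable]: "g m \<in> borel_measurable M" for m
    by (rule borel_measurable_integrable[OF int_g])
  have "(\<integral>\<^sup>+\<omega>. (\<Sum>m. ennreal (norm (g m \<omega>))) \<partial>M) = (\<Sum>m. \<integral>\<^sup>+\<omega>. norm (g m \<omega>) \<partial>M)"
    by (intro nn_integral_suminf) auto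
  also have "\<dots> = (\<Sum>m. ennreal (\<integral>\<omega>. norm (g m \<omega>) \<partial>M))"
    by (intro arg_cong[where f = suminf] ext nn_integral_eq_integral integrable_norm int_g) auto
  also have "\<dots> \<noteq> \<infinity>"
    using sum_g by (simp add: ennreal_suminf_neq_top integral_nonneg_AE)
  finally have "AE \<omega> in M. (\<Sum>m. ennreal (norm (g m \<omega>))) \<noteq> \<infinity>"
    by (intro nn_integral_PInf_AE) auto
  then show ?thesis
  proof eventually_elim
    case (elim \<omega>)
    then have "summable (\<lambda>m. norm (g m \<omega>))"
      by (intro summable_suminf_not_top) auto
    then show ?case
      unfolding g_def by (simp add: summable_nat_extend_norm)
  qed
qed

text \<open>Termwise integration of unordered series. The sum enters as a function \<open>S\<close>
  that need only agree with the series almost everywhere, so its measurability is a separate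
  hypothesis.\<close>

lemma
  fixes f :: "'i :: countable \<Rightarrow> 'w \<Rightarrow> 'b :: {banach, second_countable_topology}"
  assumes int: "\<And>i. integrable M (f i)"
    and sum: "(\<lambda>i. \<integral>\<omega>. norm (f i \<omega>) \<partial>M) summable_on UNIV"
    and S: "AE \<omega> in M. ((\<lambda>i. f i \<omega>) has_sum S \<omega>) UNIV"
    and [measurable]: "S \<in> borel_measurable M"
  shows integrable_has_sum: "integrable M S"
    and has_sum_integral: "((\<lambda>i. \<integral>\<omega>. f i \<omega> \<partial>M) has_sum (\<integral>\<omega>. S \<omega> \<partial>M)) UNIV"
proof -
  define g where "g = (\<lambda>m \<omega>. nat_extend (\<lambda>i. f i \<omega>) m)"
  have int_g: "integrable M (g m)" for m
    using int by (cases "m \<in> range (to_nat :: 'i \<Rightarrow> nat)") (auto simp: g_def nat_extend_def)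
  have "(\<integral>\<omega>. norm (g m \<omega>) \<partial>M) = nat_extend (\<lambda>i. \<integral>\<omega>. norm (f i \<omega>) \<partial>M) m" for m
    by (auto simp: g_def nat_extend_def)
  then have sum_g: "summable (\<lambda>m. \<integral>\<omega>. norm (g m \<omega>) \<partial>M)"
    using sum by (intro summable_on_imp_summable) (simp add: summable_on_nat_extend)
  have AE_g: "AE \<omega> in M. summable (\<lambda>m. norm (g m \<omega>))"
    using AE_norm_summable_on[OF int sum] by (simp add: g_def summable_nat_extend_norm)
  have [measurable]: "g m \<in> borel_measurable M" for m
    by (rule borel_measurable_integrable[OF int_g])
  have eq: "AE \<omega> in M. (\<Sum>m. g m \<omega>) = S \<omega>"
    using S
  proof eventually_elim
    case (elim \<omega>)
    then have "((\<lambda>m. g m \<omega>) has_sum S \<omega>) UNIV"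
      by (simp add: g_def has_sum_nat_extend)
    from has_sum_imp_sums[OF this] show ?case
      by (rule sums_unique[symmetric])
  qed
  show "integrable M S"
    using integrable_suminf[OF int_g AE_g sum_g] integrable_cong_AE[OF _ _ eq] by auto
  have int_eq: "(\<integral>\<omega>. g m \<omega> \<partial>M) = nat_extend (\<lambda>i. \<integral>\<omega>. f i \<omega> \<partial>M) m" for m
    by (auto simp: g_def nat_extend_def)
  have "(\<lambda>m. \<integral>\<omega>. g m \<omega> \<partial>M) sums (\<integral>\<omega>. (\<Sum>m. g m \<omega>) \<partial>M)"
    by (rule sums_integral[OF int_g AE_g sum_g])
  also have "(\<integral>\<omega>. (\<Sum>m. g m \<omega>) \<partial>M) = (\<integral>\<omega>. S \<omega> \<partial>M)"
    using eq by (intro integral_cong_AE) auto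
  finally have "(\<lambda>m. \<integral>\<omega>. g m \<omega> \<partial>M) sums (\<integral>\<omega>. S \<omega> \<partial>M)" .
  \<comment> \<open>Absolute convergence upgrades the ordered sum over the naturals to an unordered
    one.\<close>
  moreover have "summable (\<lambda>m. norm (\<integral>\<omega>. g m \<omega> \<partial>M))"
    by (rule summable_comparison_test'[OF sum_g, of 0]) auto
  ultimately have "((\<lambda>m. \<integral>\<omega>. g m \<omega> \<partial>M) has_sum (\<integral>\<omega>. S \<omega> \<partial>M)) UNIV"
    by (rule norm_summable_imp_has_sum[rotated])
  then show "((\<lambda>i. \<integral>\<omega>. f i \<omega> \<partial>M) has_sum (\<integral>\<omega>. S \<omega> \<partial>M)) UNIV"
    by (simp add: int_eq has_sum_nat_extend)
qed

text \<open>In finite dimension unconditional convergence is absolute: this holds for each real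
  coordinate, and the sum of the absolute coordinates dominates the norm.\<close>

lemma summable_on_imp_norm_summable_on:
  fixes f :: "'i \<Rightarrow> 'b :: euclidean_space"
  assumes "f summable_on A"
  shows "(\<lambda>i. norm (f i)) summable_on A"
proof (rule summable_on_comparison_test)
  have "(\<lambda>i. norm (f i \<bullet> e)) summable_on A" for e
    using summable_on_bounded_linear[OF bounded_linear_inner_left assms, of e]
    by (rule summable_on_iff_abs_summable_on_real[THEN iffD1])
  then have "((\<lambda>i. \<Sum>e\<in>Basis. norm (f i \<bullet> e)) has_sum
      (\<Sum>e\<in>Basis. \<Sum>\<^sub>\<infinity>i\<in>A. norm (f i \<bullet> e))) A"
    by (intro has_sum_sum has_sum_infsum)
  then show "(\<lambda>i. \<Sum>e\<in>Basis. norm (f i \<bullet> e)) summable_on A"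
    by (rule has_sum_imp_summable)
qed (auto simp: norm_le_l1)

text \<open>In a Euclidean space the series converges exactly where the series of norms is finite,
  and that set is measurable.\<close>

lemma borel_measurable_infsum:
  fixes f :: "'i :: countable \<Rightarrow> 'w \<Rightarrow> 'b :: euclidean_space"
  assumes [measurable]: "\<And>i. f i \<in> borel_measurable M"
  shows "(\<lambda>\<omega>. \<Sum>\<^sub>\<infinity>i. f i \<omega>) \<in> borel_measurable M"
proof -
  define g where "g = (\<lambda>m \<omega>. nat_extend (\<lambda>i. f i \<omega>) m)"
  have [measurable]: "g m \<in> borel_measurable M" for m
    by (cases "m \<in> range (to_nat :: 'i \<Rightarrow> nat)") (auto simp: g_def nat_extend_def)
  \<comment> \<open>The \<open>else\<close> branch reproduces the default value 0 of
    \<open>infsum\<close> at points of divergence, so the identity holds at every \<omega>.\<close>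
  have "(\<Sum>\<^sub>\<infinity>i. f i \<omega>) =
      (if (\<Sum>m. ennreal (norm (g m \<omega>))) \<noteq> \<infinity> then (\<Sum>m. g m \<omega>) else 0)" for \<omega>
  proof (cases "summable (\<lambda>m. norm (g m \<omega>))")
    case True
    then have "((\<lambda>m. g m \<omega>) has_sum (\<Sum>m. g m \<omega>)) UNIV"
      by (rule norm_summable_imp_has_sum) (rule summable_sums[OF summable_norm_cancel[OF True]])
    then have "(\<Sum>\<^sub>\<infinity>i. f i \<omega>) = (\<Sum>m. g m \<omega>)"
      by (simp add: g_def has_sum_nat_extend infsumI)
    with True show ?thesis
      by (simp add: ennreal_suminf_neq_top)
  next
    case False
    then have "\<not> (\<lambda>i. f i \<omega>) summable_on UNIV"
      using summable_on_imp_norm_summable_on[of "\<lambda>i. f i \<omega>" UNIV]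
      by (auto simp: g_def summable_nat_extend_norm)
    moreover have "(\<Sum>m. ennreal (norm (g m \<omega>))) = \<infinity>"
      using False summable_suminf_not_top[of "\<lambda>m. norm (g m \<omega>)"]
      by (metis norm_ge_zero infinity_ennreal_def)
    ultimately show ?thesis
      by (simp add: infsum_not_exists)
  qed
  then show ?thesis by simp
qed

text \<open>Absolute summability of the double family comes from the product of the norms; its sum
  is then computed iteratively, first over \<open>j\<close>, then over \<open>i\<close>.\<close>

lemma
  fixes f :: "'i \<Rightarrow> 'a :: banach" and g :: "'j \<Rightarrow> 'b :: banach"
    and prod :: "'a \<Rightarrow> 'b \<Rightarrow> 'c :: banach"
  assumes prod: "bounded_bilinear prod"
    and f: "(\<lambda>i. norm (f i)) summable_on UNIV" and g: "(\<lambda>j. norm (g j)) summable_on UNIV"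
  shows abs_summable_on_bilinear: "(\<lambda>(i, j). norm (prod (f i) (g j))) summable_on UNIV"
    and has_sum_bilinear: "((\<lambda>(i, j). prod (f i) (g j)) has_sum prod (infsum f UNIV) (infsum g UNIV)) UNIV"
proof -
  interpret bounded_bilinear prod by fact
  obtain K where K: "\<And>x y. norm (prod x y) \<le> norm x * norm y * K"
    using bounded by blast
  have "(\<lambda>(i, j). norm (f i) * norm (g j)) summable_on UNIV \<times> UNIV"
  proof (rule summable_on_SigmaI)
    show "((\<lambda>j. case (i, j) of (i, j) \<Rightarrow> norm (f i) * norm (g j)) has_sum
        norm (f i) * infsum (\<lambda>j. norm (g j)) UNIV) UNIV" for i
      using has_sum_cmult_right[OF has_sum_infsum[OF g]] by simp
    show "(\<lambda>i. norm (f i) * infsum (\<lambda>j. norm (g j)) UNIV) summable_on UNIV"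
      by (rule summable_on_cmult_left[OF f])
  qed auto
  then have "(\<lambda>(i, j). norm (f i) * norm (g j) * K) summable_on UNIV"
    using summable_on_cmult_left[of "\<lambda>(i, j). norm (f i) * norm (g j)" UNIV K]
    by (simp add: case_prod_unfold)
  then show abs: "(\<lambda>(i, j). norm (prod (f i) (g j))) summable_on UNIV"
    by (rule summable_on_comparison_test) (auto simp: K)
  have f': "(f has_sum infsum f UNIV) UNIV" and g': "(g has_sum infsum g UNIV) UNIV"
    by (rule has_sum_infsum[OF abs_summable_summable[OF f]])
      (rule has_sum_infsum[OF abs_summable_summable[OF g]])
  have "((\<lambda>(i, j). prod (f i) (g j)) has_sum prod (infsum f UNIV) (infsum g UNIV)) (UNIV \<times> UNIV)"
  proof (rule has_sum_SigmaI)
    show "((\<lambda>j. case (i, j) of (i, j) \<Rightarrow> prod (f i) (g j)) has_sum prod (f i) (infsum g UNIV)) UNIV" for i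
      using has_sum_bounded_linear[OF bounded_linear_right g'] by simp
    show "((\<lambda>i. prod (f i) (infsum g UNIV)) has_sum prod (infsum f UNIV) (infsum g UNIV)) UNIV"
      by (rule has_sum_bounded_linear[OF bounded_linear_left f'])
    show "(\<lambda>(i, j). prod (f i) (g j)) summable_on UNIV \<times> UNIV"
      using abs by (simp add: case_prod_unfold abs_summable_summable)
  qed
  then show "((\<lambda>(i, j). prod (f i) (g j)) has_sum prod (infsum f UNIV) (infsum g UNIV)) UNIV"
    by simp
qed

section \<open>Matrix identities for traces and inner products\<close>

lemma bounded_bilinear_matrix_vector_mult:
  "bounded_bilinear ((*v) :: real ^ 'n ^ 'm \<Rightarrow> real ^ 'n \<Rightarrow> real ^ 'm)"
  unfolding bilinear_conv_bounded_bilinear[symmetric] bilinear_def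
  by (auto intro!: linearI simp: matrix_vector_mult_def vec_eq_iff algebra_simps
      sum.distrib sum_distrib_left)

lemma bounded_bilinear_trace_transpose:
  fixes S :: "complex ^ 'n ^ 'n"
  shows "bounded_bilinear (\<lambda>A B. trace (S ** transpose A ** B))"
  unfolding bilinear_conv_bounded_bilinear[symmetric] bilinear_def
  by (auto intro!: linearI simp: trace_def matrix_matrix_mult_def transpose_def algebra_simps
      sum.distrib sum_distrib_left sum_distrib_right scaleR_sum_right)

lemma bounded_linear_trace_mult:
  fixes A B :: "real ^ 'n ^ 'n"
  shows "bounded_linear (\<lambda>X. trace (X ** A ** B))"
  unfolding linear_conv_bounded_linear[symmetric]
  by (auto intro!: linearI simp: trace_def matrix_matrix_mult_def algebra_simps
      sum.distrib sum_distrib_left sum_distrib_right)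

text \<open>The right-hand side is linear in \<open>outer_product x y\<close>, so the expectation of
  such an inner product depends only on a correlation matrix.\<close>

lemma inner_matrix_vector_mult_eq_trace:
  fixes A B :: "real ^ 'n ^ 'n"
  shows "(A *v x) \<bullet> (B *v y) = trace (outer_product x y ** transpose B ** A)"
proof -
  have "(A *v x) \<bullet> (B *v y) = (\<Sum>i\<in>UNIV. \<Sum>q\<in>UNIV. \<Sum>s\<in>UNIV. x $ q * y $ s * B $ i $ s * A $ i $ q)"
    by (simp add: inner_vec_def matrix_vector_mult_def sum_product mult_ac)
  also have "\<dots> = (\<Sum>q\<in>UNIV. \<Sum>i\<in>UNIV. \<Sum>s\<in>UNIV. x $ q * y $ s * B $ i $ s * A $ i $ q)"
    by (rule sum.swap)
  also have "\<dots> = trace (outer_product x y ** transpose B ** A)"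
    by (simp add: trace_def matrix_matrix_mult_def outer_product_def transpose_def sum_distrib_right)
  finally show ?thesis .
qed

section \<open>Roots of unity and the transfer function on the unit circle\<close>

text \<open>Adding the term \<open>j = 0\<close> completes a geometric sum in \<open>w\<close>, the
  \<open>m\<close>-th power of the primitive root. Since \<open>w ^ n = 1\<close>, that sum is
  \<open>n\<close> if \<open>w = 1\<close> and 0 otherwise; the final 1 removes the added
  term.\<close>

lemma sum_nontrivial_roots_unity:
  fixes m :: int
  assumes "n > 0"
  shows "(\<Sum>j=1..n-1. exp (2 * of_real pi * \<i> * of_nat j / of_nat n) powi m) =
    (if [m = 0] (mod int n) then of_nat n else 0) - (1 :: complex)"
proof -
  define w :: complex where "w = exp (2 * of_real pi * \<i> * of_int m / of_nat n)"
  have pow: "exp (2 * of_real pi * \<i> * of_nat j / of_nat n) powi m = w ^ j" for j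
    unfolding w_def exp_power_int exp_of_nat_mult[symmetric] by (simp add: mult_ac)
  have "w ^ n = exp (of_int m * (2 * of_real pi * \<i>))"
    using assms unfolding w_def exp_of_nat_mult[symmetric] by (simp add: mult_ac)
  also have "\<dots> = 1"
    unfolding exp_eq_1 by auto
  finally have wn: "w ^ n = 1" .
  have w1: "w = 1 \<longleftrightarrow> [m = 0] (mod int n)"
  proof -
    have "w = 1 \<longleftrightarrow> (\<exists>k. real_of_int m = real_of_int (k * int n))"
      using assms unfolding w_def exp_eq_1 by (auto simp: field_simps)
    also have "\<dots> \<longleftrightarrow> int n dvd m"
      unfolding of_int_eq_iff dvd_def by (auto simp: mult.commute)
    finally show ?thesis by (simp add: cong_0_iff)
  qed
  have "(\<Sum>j<n. w ^ j) = (if [m = 0] (mod int n) then of_nat n else 0)"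
    using wn w1 by (cases "w = 1") (auto simp: geometric_sum)
  moreover have "{..<n} = insert 0 {1..n-1}"
    using assms by auto
  ultimately have "1 + (\<Sum>j=1..n-1. w ^ j) = (if [m = 0] (mod int n) then of_nat n else 0)"
    by simp
  then show ?thesis
    unfolding pow by (simp only: eq_diff_eq add.commute)
qed

lemma norm_map_matrix_of_real_mult:
  fixes A :: "real ^ 'n ^ 'm"
  assumes "norm w = 1"
  shows "norm (map_matrix (\<lambda>a. complex_of_real a * w) A) = norm A"
  using assms by (simp add: norm_vec_def L2_set_def norm_mult)

lemma trace_map_matrix_of_real_mult:
  fixes S A B :: "real ^ 'n ^ 'n"
  shows "trace (map_matrix complex_of_real S ** transpose (map_matrix (\<lambda>a. complex_of_real a * v) A)
      ** map_matrix (\<lambda>a. complex_of_real a * w) B) =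
    complex_of_real (trace (S ** transpose A ** B)) * (v * w)"
  by (simp add: trace_def matrix_matrix_mult_def transpose_def sum_distrib_left sum_distrib_right mult_ac)

text \<open>On the unit circle the terms of the transfer function have the norms of the
  \<open>H j\<close>, so both series converge absolutely and the bilinear product applies; the
  phases combine to \<open>z powi (j - i)\<close>.\<close>

lemma has_sum_trace_transfer_function:
  fixes S :: "real ^ 'd ^ 'd" and H :: "int \<Rightarrow> real ^ 'd ^ 'd"
  assumes H: "(\<lambda>j. norm (H j)) summable_on UNIV" and z: "norm z = 1"
  shows "((\<lambda>(i, j). complex_of_real (trace (S ** transpose (H i) ** H j)) * z powi (j - i)) has_sum
    trace (map_matrix complex_of_real S ** transpose (transfer_function H z)
      ** transfer_function H (inverse z))) UNIV"
proof -
  define G where "G y j = map_matrix (\<lambda>a. complex_of_real a * y powi (- j)) (H j)"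
    for y :: complex and j
  have T: "transfer_function H y = infsum (G y) UNIV" for y
    by (simp add: transfer_function_def G_def[abs_def])
  have "(\<lambda>j. norm (G y j)) summable_on UNIV" if "norm y = 1" for y
    using H that by (simp add: G_def norm_map_matrix_of_real_mult norm_power_int)
  then have "((\<lambda>(i, j). trace (map_matrix complex_of_real S ** transpose (G z i) ** G (inverse z) j))
      has_sum trace (map_matrix complex_of_real S ** transpose (infsum (G z) UNIV)
        ** infsum (G (inverse z)) UNIV)) UNIV"
    using z by (intro has_sum_bilinear[OF bounded_bilinear_trace_transpose]) (auto simp: norm_inverse)
  moreover have "z powi (- i) * inverse z powi (- j) = z powi (j - i)" for i j
  proof -
    have "z \<noteq> 0" using z by auto
    then show ?thesis
      by (simp add: power_int_diff power_int_minus power_int_inverse field_simps)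
  qed
  ultimately show ?thesis
    unfolding T by (simp add: G_def[of _ "_ :: int"] trace_map_matrix_of_real_mult)
qed

section \<open>Second moment of the filtered process\<close>

text \<open>Almost sure convergence and integrability are part of the conclusion because
  \<open>infsum\<close> and the integral default to 0; they ensure that the final identity concerns
  genuine values.\<close>

theorem proposition5:
  fixes M :: "'w measure"
    and n :: nat
    and \<Sigma> :: "real ^ 'd ^ 'd"
    and b :: "int \<Rightarrow> 'w \<Rightarrow> real ^ 'd"
    and H :: "int \<Rightarrow> real ^ 'd ^ 'd"
    and k :: int
  assumes n: "n \<ge> 2"
    and b_wss: "wide_sense_stationary M b"
    and R_b: "\<And>\<kappa>. autocorrelation M b \<kappa> =
        ((1 + 1 / (real n - 1)) * (if [\<kappa> = 0] (mod int n) then 1 else 0) - 1 / (real n - 1)) *\<^sub>R \<Sigma>"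
    and H_summable: "(\<lambda>j. norm (H j)) summable_on UNIV"
  shows "(AE \<omega> in M. (\<lambda>k'. H (k - k') *v b k' \<omega>) summable_on UNIV) \<and>
    filtered_process H b k \<in> borel_measurable M \<and>
    integrable M (\<lambda>\<omega>. (norm (filtered_process H b k \<omega>))\<^sup>2) \<and>
    complex_of_real (\<integral>\<omega>. (norm (filtered_process H b k \<omega>))\<^sup>2 \<partial>M) =
        1 / (of_nat n - 1) * (\<Sum>k'=1..n-1.
          trace (map_matrix complex_of_real \<Sigma>
            ** transpose (transfer_function H (exp (2 * of_real pi * \<i> * of_nat k' / of_nat n)))
            ** transfer_function H (exp (- (2 * of_real pi * \<i> * of_nat k' / of_nat n)))))"
proof -
  interpret prob_space M using b_wss by (simp add: wide_sense_stationary_def)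
  have [measurable]: "b i \<in> borel_measurable M" for i
    using b_wss by (simp add: wide_sense_stationary_def)
  have sq: "integrable M (\<lambda>\<omega>. (norm (b i \<omega>))\<^sup>2)" for i
    using b_wss by (simp add: wide_sense_stationary_def)
  define r where "r \<kappa> = (1 + 1 / (real n - 1)) * (if [\<kappa> = 0] (mod int n) then 1 else 0)
    - 1 / (real n - 1)" for \<kappa> :: int
  \<comment> \<open>The transposed factor comes first, hence the swapped order \<open>t B A\<close>
    in \<open>integral_inner\<close>.\<close>
  define t where "t A B = trace (\<Sigma> ** transpose A ** B)" for A B :: "real ^ 'd ^ 'd"
  have corr: "(\<integral>\<omega>. outer_product (b i \<omega>) (b j \<omega>) \<partial>M) = r (j - i) *\<^sub>R \<Sigma>" for i j
    using autocorrelation_base_point[OF b_wss, of i "j - i"] R_b[of "j - i"] by (simp add: r_def)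
  have int_outer: "integrable M (\<lambda>\<omega>. outer_product (b i \<omega>) (b j \<omega>))" for i j
    by (intro integrable_outer_product sq) simp_all
  have int_inner: "integrable M (\<lambda>\<omega>. (A *v b i \<omega>) \<bullet> (B *v b j \<omega>))" for A B :: "real ^ 'd ^ 'd" and i j
    unfolding inner_matrix_vector_mult_eq_trace
    by (rule integrable_bounded_linear[OF bounded_linear_trace_mult int_outer])
  have integral_inner: "(\<integral>\<omega>. (A *v b i \<omega>) \<bullet> (B *v b j \<omega>) \<partial>M) = r (j - i) * t B A" for A B :: "real ^ 'd ^ 'd" and i j
  proof -
    have "(\<integral>\<omega>. (A *v b i \<omega>) \<bullet> (B *v b j \<omega>) \<partial>M) = trace ((r (j - i) *\<^sub>R \<Sigma>) ** transpose B ** A)"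
      unfolding inner_matrix_vector_mult_eq_trace corr[symmetric]
      by (rule integral_bounded_linear[OF bounded_linear_trace_mult int_outer])
    also have "\<dots> = r (j - i) * t B A"
      using linear_cmul[OF bounded_linear.linear[OF bounded_linear_trace_mult[of "transpose B" A]],
          of "r (j - i)" \<Sigma>]
      by (simp add: t_def)
    finally show ?thesis .
  qed
  \<comment> \<open>This is \<open>r 0\<close> times the trace of \<Sigma>, the common second moment
    of all \<open>b i\<close>.\<close>
  define s where "s = r 0 * t (mat 1) (mat 1)"
  have sq_eq: "(\<integral>\<omega>. (norm (b i \<omega>))\<^sup>2 \<partial>M) = s" for i
    using integral_inner[of "mat 1" i "mat 1" i] by (simp add: s_def power2_norm_eq_inner)
  \<comment> \<open>The bound \<open>2xy \<le> x\<^sup>2 + y\<^sup>2\<close> makes the estimate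
    uniform in \<open>i\<close> and \<open>j\<close>.\<close>
  have prod_le: "(\<integral>\<omega>. norm (b i \<omega>) * norm (b j \<omega>) \<partial>M) \<le> s"
    and int_prod: "integrable M (\<lambda>\<omega>. norm (b i \<omega>) * norm (b j \<omega>))" for i j
  proof -
    have le: "norm (b i \<omega>) * norm (b j \<omega>) \<le> ((norm (b i \<omega>))\<^sup>2 + (norm (b j \<omega>))\<^sup>2) / 2" for \<omega>
      using sum_squares_bound[of "norm (b i \<omega>)" "norm (b j \<omega>)"] by simp
    have int: "integrable M (\<lambda>\<omega>. ((norm (b i \<omega>))\<^sup>2 + (norm (b j \<omega>))\<^sup>2) / 2)"
      using sq by simp
    show *: "integrable M (\<lambda>\<omega>. norm (b i \<omega>) * norm (b j \<omega>))"
      by (rule Bochner_Integration.integrable_bound[OF int])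
        (use le in auto)
    have "(\<integral>\<omega>. norm (b i \<omega>) * norm (b j \<omega>) \<partial>M)
        \<le> (\<integral>\<omega>. ((norm (b i \<omega>))\<^sup>2 + (norm (b j \<omega>))\<^sup>2) / 2 \<partial>M)"
      by (rule integral_mono[OF * int le])
    then show "(\<integral>\<omega>. norm (b i \<omega>) * norm (b j \<omega>) \<partial>M) \<le> s"
      using sq by (simp add: sq_eq)
  qed
  have int_b: "integrable M (b i)" for i
    using square_integrable_imp_integrable[of "\<lambda>\<omega>. norm (b i \<omega>)", OF _ sq]
    by (simp add: integrable_norm_iff)
  have norm_le: "(\<integral>\<omega>. norm (b i \<omega>) \<partial>M) \<le> (s + 1) / 2" for i
  proof -
    have "(\<integral>\<omega>. norm (b i \<omega>) \<partial>M) \<le> (\<integral>\<omega>. ((norm (b i \<omega>))\<^sup>2 + 1) / 2 \<partial>M)"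
    proof (rule integral_mono)
      show "norm (b i \<omega>) \<le> ((norm (b i \<omega>))\<^sup>2 + 1) / 2" for \<omega>
        using sum_squares_bound[of "norm (b i \<omega>)" 1] by simp
    qed (use int_b sq in simp_all)
    then show ?thesis
      using sq by (simp add: sq_eq prob_space)
  qed
  obtain K where K: "K > 0" "\<And>(A :: real ^ 'd ^ 'd) x. norm (A *v x) \<le> norm A * norm x * K"
    using bounded_bilinear.pos_bounded[OF bounded_bilinear_matrix_vector_mult] by blast

  \<comment> \<open>The substitution \<open>j = k - k'\<close> indexes the convolution by the filter
    coefficient, so the summable norms of \<open>H\<close> dominate directly.\<close>
  define X where "X j \<omega> = H j *v b (k - j) \<omega>" for j \<omega>
  have mv: "bounded_linear ((*v) A)" for A :: "real ^ 'd ^ 'd"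
    by simp
  have int_X: "integrable M (X j)" for j
    unfolding X_def by (rule integrable_bounded_linear[OF mv int_b])
  then have [measurable]: "X j \<in> borel_measurable M" for j
    by (rule borel_measurable_integrable)
  have "(\<lambda>j. \<integral>\<omega>. norm (X j \<omega>) \<partial>M) summable_on UNIV"
  proof (rule summable_on_comparison_test)
    show "(\<lambda>j. norm (H j) * (K * ((s + 1) / 2))) summable_on UNIV"
      by (rule summable_on_cmult_left[OF H_summable])
    show "(\<integral>\<omega>. norm (X j \<omega>) \<partial>M) \<le> norm (H j) * (K * ((s + 1) / 2))" for j
    proof -
      have "(\<integral>\<omega>. norm (X j \<omega>) \<partial>M) \<le> (\<integral>\<omega>. norm (H j) * K * norm (b (k - j) \<omega>) \<partial>M)"
      proof (rule integral_mono)
        show "norm (X j \<omega>) \<le> norm (H j) * K * norm (b (k - j) \<omega>)" for \<omega>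
          using K(2)[of "H j" "b (k - j) \<omega>"] by (simp add: X_def mult_ac)
      qed (use int_X int_b in simp_all)
      also have "\<dots> = norm (H j) * K * (\<integral>\<omega>. norm (b (k - j) \<omega>) \<partial>M)"
        by simp
      also have "\<dots> \<le> norm (H j) * K * ((s + 1) / 2)"
        using K(1) by (intro mult_left_mono norm_le) simp
      finally show ?thesis by (simp add: mult_ac)
    qed
  qed auto
  then have AE_X: "AE \<omega> in M. (\<lambda>j. norm (X j \<omega>)) summable_on UNIV"
    by (rule AE_norm_summable_on[OF int_X])
  have bij: "bij_betw (\<lambda>j. k - j) UNIV UNIV"
    by (rule bij_betwI[of _ _ _ "\<lambda>j. k - j"]) auto
  \<comment> \<open>Reindexing preserves \<open>infsum\<close> even where the series diverges, so
    this holds everywhere and measurability carries over.\<close>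
  have X_eq: "filtered_process H b k \<omega> = (\<Sum>\<^sub>\<infinity>j. X j \<omega>)" for \<omega>
    using infsum_reindex_bij_betw[OF bij, of "\<lambda>k'. H (k - k') *v b k' \<omega>"]
    by (simp add: filtered_process_def X_def)
  have AE: "AE \<omega> in M. (\<lambda>k'. H (k - k') *v b k' \<omega>) summable_on UNIV"
    using AE_X
  proof eventually_elim
    case (elim \<omega>)
    then have "(\<lambda>j. X j \<omega>) summable_on UNIV"
      by (rule abs_summable_summable)
    then show ?case
      using summable_on_reindex_bij_betw[OF bij, of "\<lambda>k'. H (k - k') *v b k' \<omega>"]
      by (simp add: X_def)
  qed
  have meas: "filtered_process H b k \<in> borel_measurable M"
    using borel_measurable_infsum[of X M] by (simp add: X_eq[abs_def])

  \<comment> \<open>With \<open>X j\<close> on the left, the time lag is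
    \<open>(k - i) - (k - j) = j - i\<close> and the expectation matches the exponent of
    \<open>z\<close> in the transfer function expansion.\<close>
  define F where "F = (\<lambda>(i, j) \<omega>. X j \<omega> \<bullet> X i \<omega>)"
  have int_F: "integrable M (F p)" for p
    by (cases p) (simp add: F_def X_def int_inner)
  have integral_F: "(\<integral>\<omega>. F p \<omega> \<partial>M) = (case p of (i, j) \<Rightarrow> r (j - i) * t (H i) (H j))" for p
    by (cases p) (simp add: F_def X_def integral_inner)
  have sum_F: "(\<lambda>p. \<integral>\<omega>. norm (F p \<omega>) \<partial>M) summable_on UNIV"
  proof (rule summable_on_comparison_test)
    have "(\<lambda>(i, j). norm (norm (H i) * norm (H j))) summable_on UNIV"
      by (rule abs_summable_on_bilinear[OF bounded_bilinear_mult]) (use H_summable in auto)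
    then show "(\<lambda>p. norm (norm (H (fst p)) * norm (H (snd p))) * (K\<^sup>2 * s)) summable_on UNIV"
      by (intro summable_on_cmult_left) (simp add: case_prod_unfold)
    show "(\<integral>\<omega>. norm (F p \<omega>) \<partial>M) \<le> norm (norm (H (fst p)) * norm (H (snd p))) * (K\<^sup>2 * s)" for p
    proof (cases p)
      case (Pair i j)
      let ?C = "norm (H i) * norm (H j) * K\<^sup>2"
      have "(\<integral>\<omega>. norm (F p \<omega>) \<partial>M) \<le> (\<integral>\<omega>. ?C * (norm (b (k - j) \<omega>) * norm (b (k - i) \<omega>)) \<partial>M)"
      proof (rule integral_mono)
        fix \<omega>
        have "norm (F p \<omega>) \<le> norm (X j \<omega>) * norm (X i \<omega>)"
          by (simp add: Pair F_def Cauchy_Schwarz_ineq2)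
        also have "\<dots> \<le> (norm (H j) * norm (b (k - j) \<omega>) * K) * (norm (H i) * norm (b (k - i) \<omega>) * K)"
          using K by (intro mult_mono) (auto simp: X_def less_imp_le)
        also have "\<dots> = ?C * (norm (b (k - j) \<omega>) * norm (b (k - i) \<omega>))"
          by (simp add: power2_eq_square mult_ac)
        finally show "norm (F p \<omega>) \<le> \<dots>" .
      qed (use int_F int_prod in auto)
      also have "\<dots> = ?C * (\<integral>\<omega>. norm (b (k - j) \<omega>) * norm (b (k - i) \<omega>) \<partial>M)"
        by simp
      also have "\<dots> \<le> ?C * s"
        by (intro mult_left_mono prod_le) simp
      finally show ?thesis by (simp add: Pair mult_ac)
    qed
  qed auto
  \<comment> \<open>Wherever the norms of \<open>X j\<close> are summable, the squared norm is the
    bilinear product of the series with itself.\<close>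
  have has_F: "AE \<omega> in M. ((\<lambda>p. F p \<omega>) has_sum (norm (filtered_process H b k \<omega>))\<^sup>2) UNIV"
    using AE_X
  proof eventually_elim
    case (elim \<omega>)
    then show ?case
      using has_sum_bilinear[OF bounded_bilinear_inner elim elim]
      by (simp add: F_def X_eq power2_norm_eq_inner case_prod_unfold inner_commute)
  qed
  have meas_sq: "(\<lambda>\<omega>. (norm (filtered_process H b k \<omega>))\<^sup>2) \<in> borel_measurable M"
    using meas by measurable
  note integrable = integrable_has_sum[OF int_F sum_F has_F meas_sq]
  have lhs: "((\<lambda>(i, j). complex_of_real (r (j - i) * t (H i) (H j))) has_sum
      complex_of_real (\<integral>\<omega>. (norm (filtered_process H b k \<omega>))\<^sup>2 \<partial>M)) UNIV"
    using has_sum_bounded_linear[OF bounded_linear_of_real has_sum_integral[OF int_F sum_F has_F meas_sq]]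
    by (simp add: integral_F case_prod_unfold)

  define z where "z q = exp (2 * of_real pi * \<i> * of_nat q / of_nat n)" for q :: nat
  define T where "T q = trace (map_matrix complex_of_real \<Sigma> ** transpose (transfer_function H (z q))
    ** transfer_function H (inverse (z q)))" for q
  have "norm (z q) = 1" for q
    by (simp add: z_def norm_exp_eq_Re)
  then have "((\<lambda>(i, j). complex_of_real (t (H i) (H j)) * z q powi (j - i)) has_sum T q) UNIV" for q
    unfolding t_def T_def by (rule has_sum_trace_transfer_function[OF H_summable])
  then have "((\<lambda>p. \<Sum>q=1..n-1. case p of (i, j) \<Rightarrow> complex_of_real (t (H i) (H j)) * z q powi (j - i))
      has_sum (\<Sum>q=1..n-1. T q)) UNIV"
    by (intro has_sum_sum)
  then have rhs: "((\<lambda>p. 1 / (of_nat n - 1) * (\<Sum>q=1..n-1. case p of (i, j) \<Rightarrow>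
      complex_of_real (t (H i) (H j)) * z q powi (j - i)))
      has_sum 1 / (of_nat n - 1) * (\<Sum>q=1..n-1. T q)) UNIV"
    by (rule has_sum_cmult_right)
  \<comment> \<open>Here \<open>1 + 1/(n-1) = n/(n-1)\<close> identifies the scalar autocorrelation
    with the average over the nontrivial roots; \<open>n \<ge> 2\<close> keeps the denominator
    nonzero.\<close>
  have r_eq: "1 / (of_nat n - 1) * (\<Sum>q=1..n-1. z q powi m) = complex_of_real (r m)" for m
  proof -
    have "of_nat n \<noteq> (1 :: complex)" using n by auto
    then show ?thesis
      using n sum_nontrivial_roots_unity[of n m] by (simp add: z_def r_def divide_simps)
  qed
  have "1 / (of_nat n - 1) * (\<Sum>q=1..n-1. complex_of_real (t A B) * z q powi m) =
      complex_of_real (r m * t A B)" for A B m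
    unfolding sum_distrib_left[symmetric] of_real_mult r_eq[symmetric] by (simp add: mult_ac)
  \<comment> \<open>By \<open>r_eq\<close> the families in \<open>lhs\<close> and \<open>rhs\<close>
    agree term by term, so their sums coincide.\<close>
  then have "complex_of_real (\<integral>\<omega>. (norm (filtered_process H b k \<omega>))\<^sup>2 \<partial>M) =
      1 / (of_nat n - 1) * (\<Sum>q=1..n-1. T q)"
    using has_sum_unique[OF lhs] rhs by (simp add: case_prod_unfold)
  then show ?thesis
    using AE meas integrable by (simp add: T_def z_def exp_minus)
qed

end
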